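(* Let $A\in\mathbb{R}^{m\times n}$, $b\in\mathbb{R}^m$, $p\in\{1,2\}$, and let $\phi(z)=z$ for $z\ge 0$. Let $L$ and $s_i,\rho_i,\Omega_i$ ($i\in\mathbb{N}_L^0$) be produced by the iteration described in the context for this $\phi$. Let $\sigma^*:=\min\{\|Ax-b\|_p:x\in\mathbb{R}^n\}$, and for $\sigma\ge\sigma^*$ let $G_\sigma:=\{x\in\mathbb{R}^n:\|Ax-b\|_p\le\sigma\}$, $H(\sigma):=\min\{\|x\|_0:x\in G_\sigma\}$ and $\widehat\Omega(\sigma):=\arg\min\{\|x\|_0:x\in G_\sigma\}$. Then: (i) $H(\sigma)=s_i$ if $\sigma\in[\rho_i,\rho_{i+1})$, $i\in\mathbb{N}_{L-1}^0$, and $H(\sigma)=0$ if $\sigma\ge\|b\|_p$. (ii) $\widehat\Omega(\sigma)=\Omega_i$ if $\sigma=\rho_i$, $i\in\mathbb{N}_{L-1}^0$; $\Omega_i\subseteq\widehat\Omega(\sigma)$ if $\sigma\in(\rho_i,\rho_{i+1})$, $i\in\mathbb{N}_{L-1}^0$; and $\widehat\Omega(\sigma)=\{\mathbf{0}_n\}$ if $\sigma\ge\|b\|_p$. In particular, if $p=2$, then $\Omega_i\subsetneq\widehat\Omega(\sigma)$ for $\sigma\in(\rho_i,\rho_{i+1})$, $i\in\mathbb{N}_{L-1}^0$. (iii) $H:[\sigma^*,+\infty)\to\mathbb{R}$ is a piecewise constant function and has at most $\mathrm{rank}(A)+1$ values. Further, $H$ is lower semicontinuous, right-continuous and nonincreasing.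 (iv) $\widehat\Omega(\sigma_1)\subseteq\widehat\Omega(\sigma_2)$ for any $\sigma_1,\sigma_2\in[\rho_i,\rho_{i+1})$ with $\sigma_1\le\sigma_2$, $i\in\mathbb{N}_{L-1}^0$.
   Context: $\mathbb{N}_k^0=\{0,1,\dots,k\}$ (with $\mathbb{N}_{-1}^0=\emptyset$); $\mathbf{0}_n$ is the zero vector of $\mathbb{R}^n$; $\|x\|_0$ is the number of nonzero components of $x$; $\arg\min$ denotes the set of all global minimizers. Iteration (depending on $A,b,p,\phi$). Set $i=0$ and $\rho_0:=\min\{\phi(\|Ax-b\|_p):x\in\mathbb{R}^n\}$, $s_0:=\min\{\|x\|_0:\phi(\|Ax-b\|_p)=\rho_0,\ x\in\mathbb{R}^n\}$, $\Omega_0:=\arg\min\{\|x\|_0:\phi(\|Ax-b\|_p)=\rho_0,\ x\in\mathbb{R}^n\}$. While $s_i>0$: put $\rho_{i+1}:=\min\{\phi(\|Ax-b\|_p):\|x\|_0\le s_i-1,\ x\in\mathbb{R}^n\}$, $s_{i+1}:=\min\{\|x\|_0:\phi(\|Ax-b\|_p)=\rho_{i+1},\ x\in\mathbb{R}^n\}$, $\Omega_{i+1}:=\arg\min\{\|x\|_0:\phi(\|Ax-b\|_p)=\rho_{i+1},\ x\in\mathbb{R}^n\}$, and replace $i$ by $i+1$. When the loop ends (i.e. $s_i=0$), set $L:=i$. (All these minima are attained and the iteration terminates.) *)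

theory Defs
  imports "HOL-Analysis.Analysis" "HOL-Library.Disjoint_Sets"
begin

definition lp_norm :: "nat \<Rightarrow> real^'k \<Rightarrow> real"
  where "lp_norm p x = root p (\<Sum>i\<in>UNIV. \<bar>x $ i\<bar> ^ p)"

definition l0_norm :: "real^'k \<Rightarrow> nat"
  where "l0_norm x = card {i. x $ i \<noteq> 0}"

(* An attained minimum: the value is meaningful only if f ` S has a least element
   (it is not an infimum). *)
definition min_value :: "('a \<Rightarrow> 'b::order) \<Rightarrow> 'a set \<Rightarrow> 'b"
  where "min_value f S = (LEAST v. v \<in> f ` S)"

definition minimizers :: "('a \<Rightarrow> 'b::order) \<Rightarrow> 'a set \<Rightarrow> 'a set"
  where "minimizers f S = {x. is_arg_min f (\<lambda>y. y \<in> S) x}"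

(* The iteration. The equations are total in i, but rho (i + 1) belongs to the iteration only
   while s i > 0; in that range the natural-number subtraction s i - 1 does not truncate. *)
fun rho :: "real^'n^'m \<Rightarrow> real^'m \<Rightarrow> nat \<Rightarrow> (real \<Rightarrow> real) \<Rightarrow> nat \<Rightarrow> real"
  and s :: "real^'n^'m \<Rightarrow> real^'m \<Rightarrow> nat \<Rightarrow> (real \<Rightarrow> real) \<Rightarrow> nat \<Rightarrow> nat"
  where
    "rho A b p \<phi> 0 = min_value (\<lambda>x. \<phi> (lp_norm p (A *v x - b))) UNIV"
  | "rho A b p \<phi> (Suc i) =
       min_value (\<lambda>x. \<phi> (lp_norm p (A *v x - b))) {x. l0_norm x \<le> s A b p \<phi> i - 1}"
  | "s A b p \<phi> i = min_value l0_norm {x. \<phi> (lp_norm p (A *v x - b)) = rho A b p \<phi> i}"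

definition Omega :: "real^'n^'m \<Rightarrow> real^'m \<Rightarrow> nat \<Rightarrow> (real \<Rightarrow> real) \<Rightarrow> nat \<Rightarrow> (real^'n) set"
  where "Omega A b p \<phi> i =
    minimizers l0_norm {x. \<phi> (lp_norm p (A *v x - b)) = rho A b p \<phi> i}"

definition last_index :: "real^'n^'m \<Rightarrow> real^'m \<Rightarrow> nat \<Rightarrow> (real \<Rightarrow> real) \<Rightarrow> nat"
  where "last_index A b p \<phi> = (LEAST i. s A b p \<phi> i = 0)"

definition sigma_star :: "real^'n^'m \<Rightarrow> real^'m \<Rightarrow> nat \<Rightarrow> real"
  where "sigma_star A b p = min_value (\<lambda>x. lp_norm p (A *v x - b)) UNIV"

definition G :: "real^'n^'m \<Rightarrow> real^'m \<Rightarrow> nat \<Rightarrow> real \<Rightarrow> (real^'n) set"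
  where "G A b p \<sigma> = {x. lp_norm p (A *v x - b) \<le> \<sigma>}"

definition H :: "real^'n^'m \<Rightarrow> real^'m \<Rightarrow> nat \<Rightarrow> real \<Rightarrow> nat"
  where "H A b p \<sigma> = min_value l0_norm (G A b p \<sigma>)"

definition Omega_hat :: "real^'n^'m \<Rightarrow> real^'m \<Rightarrow> nat \<Rightarrow> real \<Rightarrow> (real^'n) set"
  where "Omega_hat A b p \<sigma> = minimizers l0_norm (G A b p \<sigma>)"

definition piecewise_constant_on :: "real set \<Rightarrow> (real \<Rightarrow> real) \<Rightarrow> bool"
  where "piecewise_constant_on S f \<longleftrightarrow>
    (\<exists>P. finite P \<and> partition_on S P \<and> (\<forall>I\<in>P. is_interval I \<and> f constant_on I))"

definition lower_semicontinuous_on :: "real set \<Rightarrow> (real \<Rightarrow> real) \<Rightarrow> bool"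
  where "lower_semicontinuous_on S f \<longleftrightarrow>
    (\<forall>x\<in>S. \<forall>c<f x. \<forall>\<^sub>F y in at x within S. c < f y)"

end

theory Submission
  imports Defs
begin

text \<open>
  For each k the residual attains its minimum over the vectors with at most k nonzero entries, since
  the image of this set under A is a finite union of subspaces, hence closed. By minimality of
  \<open>s i\<close> and \<open>rho i\<close>, a residual below \<open>rho (i + 1)\<close> needs at
  least \<open>s i\<close> nonzero entries, while \<open>s i\<close> entries suffice for
  \<open>rho i\<close>; so H is constantly \<open>s i\<close> between the two thresholds. If
  \<open>H \<sigma> = k + 1\<close>, then \<sigma> lies strictly below the best residual of the vectors with
  at most k nonzero entries, and H keeps its value up to there: this gives right continuity, and with
  monotonicity lower semicontinuity. The values of H are at most the rank of A because every vector
  of the column space is a combination of a basis chosen among the columns. For p = 2, scaling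
  \<open>x \<in> Omega i\<close> by \<open>1 \<plusminus> e\<close> keeps its support and changes the residual
  slightly, and by the parallelogram law the residual cannot be the same for both scalings as for x.
\<close>

declare rho.simps [simp del] s.simps [simp del]

section \<open>Elementary properties of \<open>lp_norm\<close> and \<open>l0_norm\<close>\<close>

lemma lp_norm_nonneg: "0 \<le> lp_norm p x"
  unfolding lp_norm_def by (cases "p = 0") (auto intro!: real_root_ge_zero sum_nonneg)

lemma lp_norm_2: "lp_norm 2 x = norm x"
  by (simp add: lp_norm_def norm_vec_def L2_set_def sqrt_def)

text \<open>This comparison confines the image points with bounded residual to a Euclidean ball,
  which is what the compactness argument uses.\<close>

lemma norm_le_lp_norm:
  assumes "p \<in> {1, 2}"
  shows "norm x \<le> lp_norm p x"
  using assms
proof (elim insertE emptyE)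
  show "norm x \<le> lp_norm p x" if "p = 1"
    using that norm_le_l1_cart[of x] by (simp add: lp_norm_def)
qed (simp add: lp_norm_2)

lemma lp_norm_uminus: "lp_norm p (- x) = lp_norm p x"
  by (simp add: lp_norm_def)

lemma continuous_on_lp_norm:
  assumes "continuous_on S f"
  shows "continuous_on S (\<lambda>x. lp_norm p (f x))"
  unfolding lp_norm_def by (intro continuous_intros assms)

lemma l0_norm_eq_0_iff: "l0_norm x = 0 \<longleftrightarrow> x = 0"
  by (simp add: l0_norm_def vec_eq_iff)

lemma l0_norm_0 [simp]: "l0_norm 0 = 0"
  by (simp add: l0_norm_def)

lemma l0_norm_scaleR: "c \<noteq> 0 \<Longrightarrow> l0_norm (c *\<^sub>R x) = l0_norm x"
  by (simp add: l0_norm_def)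

section \<open>Attained minima and their minimizers\<close>

lemma min_value_eqI:
  assumes "x \<in> S" "\<And>y. y \<in> S \<Longrightarrow> f x \<le> f y"
  shows "min_value f S = f x"
  unfolding min_value_def by (rule Least_equality) (use assms in auto)

lemma minimizers_eq:
  fixes f :: "'a \<Rightarrow> 'b::linorder"
  assumes "x \<in> S" "\<And>y. y \<in> S \<Longrightarrow> f x \<le> f y"
  shows "minimizers f S = {y \<in> S. f y = min_value f S}"
proof -
  have "min_value f S = f x"
    using assms by (rule min_value_eqI)
  then show ?thesis
    using assms by (auto simp: minimizers_def is_arg_min_linorder intro: order.antisym)
qed

lemma nat_minimum_attained:
  fixes f :: "'a \<Rightarrow> nat"
  assumes "S \<noteq> {}"
  obtains x where "x \<in> S" "\<And>y. y \<in> S \<Longrightarrow> f x \<le> f y"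
  using assms ex_has_least_nat[of "\<lambda>x. x \<in> S" _ f] by blast

section \<open>Best approximation by sparse vectors\<close>

lemma closed_image_sparse:
  fixes A :: "real^'n^'m"
  shows "closed ((*v) A ` {x. l0_norm x \<le> k})"
proof -
  \<comment> \<open>One coordinate subspace for each candidate support \<open>T\<close>; there are
    only finitely many.\<close>
  have eq: "{x :: real^'n. l0_norm x \<le> k} = (\<Union>T\<in>{T. card T \<le> k}. {x. \<forall>i. i \<notin> T \<longrightarrow> x $ i = 0})"
    (is "?L = ?R")
  proof
    show "?L \<subseteq> ?R"
      by (auto simp: l0_norm_def)
    show "?R \<subseteq> ?L"
    proof
      fix x assume "x \<in> ?R"
      then obtain T where T: "card T \<le> k" "\<And>i. i \<notin> T \<Longrightarrow> x $ i = 0" by auto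
      have "card {i. x $ i \<noteq> 0} \<le> card T"
        using T(2) by (intro card_mono) auto
      with T(1) show "x \<in> ?L" by (simp add: l0_norm_def)
    qed
  qed
  have "subspace {x :: real^'n. \<forall>i. i \<notin> T \<longrightarrow> x $ i = 0}" for T
    by (simp add: subspace_def)
  then have "closed ((*v) A ` {x. \<forall>i. i \<notin> T \<longrightarrow> x $ i = 0})" for T
    by (intro closed_subspace linear_subspace_image matrix_vector_mul_linear)
  then show ?thesis
    unfolding eq image_UN by (intro closed_UN) auto
qed

text \<open>Minimizing over the image points \<open>A *v x\<close> instead of over \<open>x\<close>
  gives compactness even when \<open>A\<close> has a kernel, along which the residual does not
  grow.\<close>

lemma closest_sparse_image:
  fixes A :: "real^'n^'m"
  assumes p: "p \<in> {1, 2}"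
  obtains x where "l0_norm x \<le> k"
    "\<And>y. l0_norm y \<le> k \<Longrightarrow> lp_norm p (A *v x - b) \<le> lp_norm p (A *v y - b)"
proof -
  \<comment> \<open>The radius is the residual of the zero vector, so points outside the ball cannot
    do better than \<open>0\<close>.\<close>
  let ?C = "(*v) A ` {x. l0_norm x \<le> k} \<inter> cball b (lp_norm p b)"
  have "norm b \<le> lp_norm p b" using norm_le_lp_norm[OF p] .
  then have 0: "0 \<in> ?C"
    by (auto simp: dist_norm intro!: image_eqI[of _ _ 0])
  have "compact ?C"
    by (intro closed_Int_compact closed_image_sparse compact_cball)
  moreover have "continuous_on ?C (\<lambda>z. lp_norm p (z - b))"
    by (intro continuous_on_lp_norm continuous_intros)
  ultimately obtain z where z: "z \<in> ?C"
    and le: "\<And>w. w \<in> ?C \<Longrightarrow> lp_norm p (z - b) \<le> lp_norm p (w - b)"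
    using continuous_attains_inf[of ?C] 0 by blast
  from z obtain x where x: "l0_norm x \<le> k" "z = A *v x" by auto
  show thesis
  proof
    fix y :: "real^'n" assume y: "l0_norm y \<le> k"
    show "lp_norm p (A *v x - b) \<le> lp_norm p (A *v y - b)"
    proof (cases "A *v y \<in> ?C")
      case False
      then have "lp_norm p b < norm (A *v y - b)"
        using y by (auto simp: dist_norm norm_minus_commute)
      also have "\<dots> \<le> lp_norm p (A *v y - b)" using norm_le_lp_norm[OF p] .
      finally show ?thesis using le[OF 0] by (simp add: x lp_norm_uminus)
    qed (use le x in auto)
  qed (use x in auto)
qed

section \<open>Sparse preimages of points of the column space\<close>

lemma sparse_representation:
  fixes A :: "real^'n^'m"
  obtains y where "A *v y = A *v x" "l0_norm y \<le> rank A"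
proof -
  obtain B where B: "B \<subseteq> columns A" "independent B" "columns A \<subseteq> span B" "card B = dim (columns A)"
    using basis_exists by metis
  have "finite B" using B(2) independent_bound by blast
  have "A *v x \<in> span (columns A)"
    using matrix_vector_mult_in_columnspace by blast
  then have "A *v x \<in> span B" using span_minimal[OF B(3) subspace_span] by blast
  then obtain u where u: "A *v x = (\<Sum>v\<in>B. u v *\<^sub>R v)"
    using span_finite[OF \<open>finite B\<close>] by auto
  have "\<forall>v\<in>B. \<exists>j. column j A = v" using B(1) by (auto simp: columns_def)
  then obtain c where c: "\<And>v. v \<in> B \<Longrightarrow> column (c v) A = v" by metis
  \<comment> \<open>Taking the column of a given index is a left inverse of \<open>c\<close> on
    \<open>B\<close>.\<close>
  then have inj: "inj_on c B" by (intro inj_on_inverseI)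
  \<comment> \<open>The coefficient of each basis vector moves to the index chosen for it, so the
    support has at most \<open>card B\<close> elements.\<close>
  define y :: "real^'n" where "y = (\<Sum>v\<in>B. u v *\<^sub>R axis (c v) 1)"
  show thesis
  proof
    have "A *v y = (\<Sum>v\<in>B. u v *\<^sub>R (A *v axis (c v) 1))"
      by (simp add: y_def matrix_vector_mult_scaleR  linear_sum[OF matrix_vector_mul_linear])
    then show "A *v y = A *v x"
      by (simp add: u c matrix_vector_mult_basis)
    have "{i. y $ i \<noteq> 0} \<subseteq> c ` B"
    proof
      fix i assume "i \<in> {i. y $ i \<noteq> 0}"
      then have "(\<Sum>v\<in>B. u v * axis (c v) 1 $ i) \<noteq> 0" by (simp add: y_def)
      then obtain v where "v \<in> B" "u v * axis (c v) 1 $ i \<noteq> 0" by (rule sum.not_neutral_contains_not_neutral)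
      then show "i \<in> c ` B" by (auto simp: axis_def split: if_splits)
    qed
    then have "l0_norm y \<le> card (c ` B)"
      unfolding l0_norm_def by (intro card_mono) (use \<open>finite B\<close> in auto)
    then show "l0_norm y \<le> rank A"
      using B(4) inj by (simp add: card_image column_rank_def)
  qed
qed

section \<open>Monotone functions with finitely many values\<close>

lemma piecewise_constant_on_antimono:
  fixes f :: "real \<Rightarrow> real"
  assumes fin: "finite (f ` S)" and S: "is_interval S" and mono: "antimono_on S f"
  shows "piecewise_constant_on S f"
  unfolding piecewise_constant_on_def
proof (intro exI conjI ballI)
  \<comment> \<open>The pieces are the level sets. Only values taken on \<open>S\<close> are used,
    so no piece is empty; monotonicity makes each one an interval.\<close>
  let ?P = "(\<lambda>c. {t \<in> S. f t = c}) ` f ` S"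
  show "finite ?P" using fin by simp
  show "partition_on S ?P"
    by (intro partition_onI) (auto simp: disjnt_def)
  fix I assume "I \<in> ?P"
  then obtain c where I: "I = {t \<in> S. f t = c}" by auto
  show "f constant_on I" by (auto simp: I constant_on_def)
  show "is_interval I"
    unfolding is_interval_1
  proof (intro allI impI ballI)
    fix t u v assume t: "t \<in> I" and u: "u \<in> I" and tv: "t \<le> v \<and> v \<le> u"
    then have v: "v \<in> S" using S unfolding I is_interval_1 by blast
    have "f u \<le> f v" "f v \<le> f t"
      using mono t u v tv unfolding I monotone_on_def by blast+
    with t u v show "v \<in> I" by (simp add: I)
  qed
qed

section \<open>The function \<open>H\<close> and the solution sets \<open>Omega_hat\<close>\<close>

context
  fixes A :: "real^'n^'m" and b :: "real^'m" and p :: nat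
  assumes p: "p \<in> {1, 2}"
begin

lemma sigma_star_least:
  obtains x where "sigma_star A b p = lp_norm p (A *v x - b)"
    "\<And>y. sigma_star A b p \<le> lp_norm p (A *v y - b)"
proof -
  \<comment> \<open>With \<open>CARD('n)\<close> as bound, the sparsity constraint holds for every
    vector.\<close>
  obtain x :: "real^'n" where
    "\<And>y. l0_norm y \<le> CARD('n) \<Longrightarrow> lp_norm p (A *v x - b) \<le> lp_norm p (A *v y - b)"
    using closest_sparse_image[OF p] by metis
  then have x: "lp_norm p (A *v x - b) \<le> lp_norm p (A *v y - b)" for y
    by (simp add: l0_norm_def card_mono)
  then have "sigma_star A b p = lp_norm p (A *v x - b)"
    unfolding sigma_star_def by (intro min_value_eqI) auto
  with x that show thesis by simp
qed

lemma G_nonempty_iff: "G A b p \<sigma> \<noteq> {} \<longleftrightarrow> sigma_star A b p \<le> \<sigma>"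
proof -
  obtain x where x: "sigma_star A b p = lp_norm p (A *v x - b)"
    "\<And>y. sigma_star A b p \<le> lp_norm p (A *v y - b)"
    by (rule sigma_star_least) blast
  then show ?thesis
    unfolding G_def by (auto intro: order.trans)
qed

lemma H_attained:
  assumes "sigma_star A b p \<le> \<sigma>"
  obtains x where "x \<in> G A b p \<sigma>" "l0_norm x = H A b p \<sigma>"
    "\<And>y. y \<in> G A b p \<sigma> \<Longrightarrow> H A b p \<sigma> \<le> l0_norm y"
proof -
  obtain x where x: "x \<in> G A b p \<sigma>" "\<And>y. y \<in> G A b p \<sigma> \<Longrightarrow> l0_norm x \<le> l0_norm y"
    using nat_minimum_attained assms G_nonempty_iff by metis
  then have "H A b p \<sigma> = l0_norm x"
    unfolding H_def by (intro min_value_eqI)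
  with x that show thesis by simp
qed

lemma Omega_hat_eq:
  assumes "sigma_star A b p \<le> \<sigma>"
  shows "Omega_hat A b p \<sigma> = {x \<in> G A b p \<sigma>. l0_norm x = H A b p \<sigma>}"
proof -
  obtain x where x: "x \<in> G A b p \<sigma>" "l0_norm x = H A b p \<sigma>"
    "\<And>y. y \<in> G A b p \<sigma> \<Longrightarrow> H A b p \<sigma> \<le> l0_norm y"
    by (rule H_attained[OF assms]) blast
  show ?thesis
    unfolding Omega_hat_def H_def by (rule minimizers_eq[of x]) (use x in auto)
qed

text \<open>Membership in \<open>G\<close> depends only on \<open>A *v x\<close>, so a feasible
  vector may be replaced by a sparse one with the same image.\<close>

lemma H_le_rank:
  assumes "sigma_star A b p \<le> \<sigma>"
  shows "H A b p \<sigma> \<le> rank A"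
proof -
  obtain x where x: "x \<in> G A b p \<sigma>"
    "\<And>y. y \<in> G A b p \<sigma> \<Longrightarrow> H A b p \<sigma> \<le> l0_norm y"
    using H_attained[OF assms] by metis
  obtain y where "A *v y = A *v x" "l0_norm y \<le> rank A"
    using sparse_representation .
  moreover from this have "y \<in> G A b p \<sigma>" using x(1) by (simp add: G_def)
  ultimately show ?thesis using x(2) by force
qed

lemma H_antimono:
  assumes "sigma_star A b p \<le> \<sigma>" "\<sigma> \<le> \<tau>"
  shows "H A b p \<tau> \<le> H A b p \<sigma>"
proof -
  obtain x where x: "x \<in> G A b p \<sigma>" "l0_norm x = H A b p \<sigma>"
    using H_attained[OF assms(1)] by metis
  then have "x \<in> G A b p \<tau>"
    using assms(2) by (simp add: G_def)
  moreover have "sigma_star A b p \<le> \<tau>" using assms by simp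
  ultimately show ?thesis
    using H_attained[of \<tau>] x(2) by metis
qed

text \<open>This is the common source of right continuity and lower semicontinuity.\<close>

lemma H_right_constant:
  assumes "sigma_star A b p \<le> \<sigma>"
  obtains \<tau> where "\<sigma> < \<tau>" "\<And>t. t \<in> {\<sigma>..<\<tau>} \<Longrightarrow> H A b p t = H A b p \<sigma>"
proof (cases "H A b p \<sigma>")
  case 0
  \<comment> \<open>Once \<open>H\<close> is zero it stays zero by monotonicity; the length 1 is
    arbitrary.\<close>
  then have "H A b p t = H A b p \<sigma>" if "t \<in> {\<sigma>..<\<sigma> + 1}" for t
    using H_antimono[OF assms, of t] that by simp
  then show thesis
    by (rule that[rotated]) auto
next
  case (Suc k)
  obtain x :: "real^'n" where x: "l0_norm x \<le> k"
    "\<And>y. l0_norm y \<le> k \<Longrightarrow> lp_norm p (A *v x - b) \<le> lp_norm p (A *v y - b)"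
    by (rule closest_sparse_image[OF p]) blast
  show thesis
  \<comment> \<open>The threshold is the smallest residual reachable with at most \<open>k\<close>
    nonzero entries, one fewer than \<open>H\<close> requires at \<open>\<sigma>\<close>.\<close>
  proof (rule that[of "lp_norm p (A *v x - b)"])
    show "\<sigma> < lp_norm p (A *v x - b)"
    proof (rule ccontr)
      assume "\<not> \<sigma> < lp_norm p (A *v x - b)"
      then have "x \<in> G A b p \<sigma>" by (simp add: G_def)
      then have "H A b p \<sigma> \<le> l0_norm x" using H_attained[OF assms] by metis
      with x(1) Suc show False by simp
    qed
    fix t assume t: "t \<in> {\<sigma>..<lp_norm p (A *v x - b)}"
    then have star: "sigma_star A b p \<le> t" using assms by simp
    obtain y where y: "y \<in> G A b p t" "l0_norm y = H A b p t"
      using H_attained[OF star] by metis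
    then have "lp_norm p (A *v y - b) < lp_norm p (A *v x - b)"
      using t by (simp add: G_def)
    then have "k < l0_norm y" using x(2)[of y] by linarith
    then show "H A b p t = H A b p \<sigma>"
      using y(2) Suc H_antimono[OF assms, of t] t by simp
  qed
qed

lemma continuous_at_right_H:
  assumes "sigma_star A b p \<le> \<sigma>"
  shows "continuous (at_right \<sigma>) (\<lambda>t. real (H A b p t))"
proof -
  obtain \<tau> where \<tau>: "\<sigma> < \<tau>" "\<And>t. t \<in> {\<sigma>..<\<tau>} \<Longrightarrow> H A b p t = H A b p \<sigma>"
    by (rule H_right_constant[OF assms]) blast
  have "\<forall>\<^sub>F t in at_right \<sigma>. real (H A b p t) = real (H A b p \<sigma>)"
    by (rule eventually_at_rightI[OF _ \<tau>(1)]) (metis \<tau>(2) atLeastLessThan_iff greaterThanLessThan_iff less_imp_le)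
  then show ?thesis
    unfolding continuous_within by (rule tendsto_eventually)
qed

lemma lower_semicontinuous_on_H:
  "lower_semicontinuous_on {sigma_star A b p..} (\<lambda>t. real (H A b p t))"
  unfolding lower_semicontinuous_on_def
proof (intro ballI allI impI)
  fix \<sigma> c assume "\<sigma> \<in> {sigma_star A b p..}" and c: "c < real (H A b p \<sigma>)"
  then have \<sigma>: "sigma_star A b p \<le> \<sigma>" by simp
  obtain \<tau> where \<tau>: "\<sigma> < \<tau>" "\<And>t. t \<in> {\<sigma>..<\<tau>} \<Longrightarrow> H A b p t = H A b p \<sigma>"
    by (rule H_right_constant[OF \<sigma>]) blast
  \<comment> \<open>To the left of \<open>\<sigma>\<close> this is monotonicity, to the right local
    constancy.\<close>
  have ge: "H A b p \<sigma> \<le> H A b p t" if "sigma_star A b p \<le> t" "t < \<tau>" for t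
    using H_antimono[OF that(1), of \<sigma>] \<tau>(2)[of t] that(2) by (cases "t \<le> \<sigma>") simp_all
  have "\<forall>\<^sub>F t in at \<sigma> within {sigma_star A b p..}. t < \<tau> \<and> t \<in> {sigma_star A b p..}"
    unfolding eventually_at_topological using \<tau>(1) by (intro exI[of _ "{..<\<tau>}"]) simp
  then show "\<forall>\<^sub>F t in at \<sigma> within {sigma_star A b p..}. c < real (H A b p t)"
    by eventually_elim (use ge c in force)
qed

lemma sigma_star_le_lp_norm: "sigma_star A b p \<le> lp_norm p b"
proof -
  have "0 \<in> G A b p (lp_norm p b)" by (simp add: G_def lp_norm_uminus)
  then show ?thesis using G_nonempty_iff by blast
qed

lemma H_eq_0:
  assumes "lp_norm p b \<le> \<sigma>"
  shows "H A b p \<sigma> = 0"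
proof -
  have "0 \<in> G A b p \<sigma>" using assms by (simp add: G_def lp_norm_uminus)
  moreover have "sigma_star A b p \<le> \<sigma>" using assms sigma_star_le_lp_norm by simp
  ultimately have "H A b p \<sigma> \<le> l0_norm (0 :: real^'n)" using H_attained by metis
  then show ?thesis by simp
qed

lemma Omega_hat_eq_singleton:
  assumes "lp_norm p b \<le> \<sigma>"
  shows "Omega_hat A b p \<sigma> = {0}"
proof -
  have "sigma_star A b p \<le> \<sigma>" using assms sigma_star_le_lp_norm by simp
  then show ?thesis
    using assms by (auto simp: Omega_hat_eq H_eq_0 l0_norm_eq_0_iff G_def lp_norm_uminus)
qed

section \<open>The iteration and its relation to \<open>H\<close> and
  \<open>Omega_hat\<close>\<close>

context
  fixes \<phi> :: "real \<Rightarrow> real"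
  assumes phi: "\<And>z. 0 \<le> z \<Longrightarrow> \<phi> z = z"
begin

lemma phi_lp_norm: "\<phi> (lp_norm p z) = lp_norm p z"
  by (simp add: phi lp_norm_nonneg)

lemma rho_0: "rho A b p \<phi> 0 = sigma_star A b p"
  by (simp add: rho.simps phi_lp_norm sigma_star_def)

text \<open>This covers \<open>s i = 0\<close> as well: the subtraction then truncates to 0 and the
  zero vector is still admissible.\<close>

lemma rho_Suc:
  obtains x where "rho A b p \<phi> (Suc i) = lp_norm p (A *v x - b)" "l0_norm x \<le> s A b p \<phi> i - 1"
    "\<And>y. l0_norm y \<le> s A b p \<phi> i - 1 \<Longrightarrow> rho A b p \<phi> (Suc i) \<le> lp_norm p (A *v y - b)"
proof -
  obtain x :: "real^'n" where x: "l0_norm x \<le> s A b p \<phi> i - 1"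
    "\<And>y. l0_norm y \<le> s A b p \<phi> i - 1 \<Longrightarrow> lp_norm p (A *v x - b) \<le> lp_norm p (A *v y - b)"
    by (rule closest_sparse_image[OF p]) blast
  then have "rho A b p \<phi> (Suc i) = lp_norm p (A *v x - b)"
    unfolding rho.simps phi_lp_norm by (intro min_value_eqI) auto
  with x that show thesis by simp
qed

lemma rho_attained: "\<exists>x. lp_norm p (A *v x - b) = rho A b p \<phi> i"
proof (cases i)
  case 0
  then show ?thesis using sigma_star_least rho_0 by metis
next
  case (Suc j)
  then show ?thesis using rho_Suc by metis
qed

lemma s_attained:
  obtains x where "lp_norm p (A *v x - b) = rho A b p \<phi> i" "l0_norm x = s A b p \<phi> i"
    "\<And>y. lp_norm p (A *v y - b) = rho A b p \<phi> i \<Longrightarrow> s A b p \<phi> i \<le> l0_norm y"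
proof -
  have "{x. lp_norm p (A *v x - b) = rho A b p \<phi> i} \<noteq> {}"
    using rho_attained by auto
  then obtain x where x: "lp_norm p (A *v x - b) = rho A b p \<phi> i"
    "\<And>y. lp_norm p (A *v y - b) = rho A b p \<phi> i \<Longrightarrow> l0_norm x \<le> l0_norm y"
    using nat_minimum_attained by (metis (mono_tags, lifting) mem_Collect_eq)
  then have "s A b p \<phi> i = l0_norm x"
    unfolding s.simps phi_lp_norm by (intro min_value_eqI) auto
  with x that show thesis by simp
qed

lemma Omega_eq:
  "Omega A b p \<phi> i = {x. lp_norm p (A *v x - b) = rho A b p \<phi> i \<and> l0_norm x = s A b p \<phi> i}"
proof -
  obtain x where "lp_norm p (A *v x - b) = rho A b p \<phi> i" "l0_norm x = s A b p \<phi> i"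
    "\<And>y. lp_norm p (A *v y - b) = rho A b p \<phi> i \<Longrightarrow> s A b p \<phi> i \<le> l0_norm y"
    by (rule s_attained) blast
  then show ?thesis
    unfolding Omega_def phi_lp_norm by (subst minimizers_eq[of x]) (auto simp: s.simps phi_lp_norm)
qed

text \<open>A vector attaining \<open>rho (Suc i)\<close> under the sparsity constraint competes in
  the minimum that defines \<open>s (Suc i)\<close>.\<close>

lemma s_Suc_le: "s A b p \<phi> (Suc i) \<le> s A b p \<phi> i - 1"
proof -
  obtain x where "lp_norm p (A *v x - b) = rho A b p \<phi> (Suc i)" "l0_norm x \<le> s A b p \<phi> i - 1"
    using rho_Suc by metis
  then show ?thesis using s_attained by (metis order.trans)
qed

text \<open>By \<open>s_Suc_le\<close>, a vector this sparse satisfies the constraint under which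
  \<open>rho i\<close> was minimized.\<close>

lemma rho_le_residual:
  assumes "l0_norm x \<le> s A b p \<phi> i"
  shows "rho A b p \<phi> i \<le> lp_norm p (A *v x - b)"
proof (cases i)
  case 0
  then show ?thesis using sigma_star_least rho_0 by metis
next
  case (Suc j)
  then have "l0_norm x \<le> s A b p \<phi> j - 1" using assms s_Suc_le[of j] by simp
  then show ?thesis using rho_Suc Suc by metis
qed

text \<open>Equality would yield a vector with residual \<open>rho i\<close> and fewer than
  \<open>s i\<close> nonzero entries.\<close>

lemma rho_less_rho_Suc:
  assumes "s A b p \<phi> i > 0"
  shows "rho A b p \<phi> i < rho A b p \<phi> (Suc i)"
proof -
  obtain x where x: "rho A b p \<phi> (Suc i) = lp_norm p (A *v x - b)" "l0_norm x \<le> s A b p \<phi> i - 1"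
    using rho_Suc by metis
  then have "rho A b p \<phi> i \<le> lp_norm p (A *v x - b)"
    by (intro rho_le_residual) simp
  moreover have "rho A b p \<phi> i \<noteq> lp_norm p (A *v x - b)"
  proof
    assume "rho A b p \<phi> i = lp_norm p (A *v x - b)"
    then have "s A b p \<phi> i \<le> l0_norm x" using s_attained by metis
    with x(2) assms show False by simp
  qed
  ultimately show ?thesis using x(1) by simp
qed

lemma s_pos_if_less_last_index: "i < last_index A b p \<phi> \<Longrightarrow> s A b p \<phi> i > 0"
  unfolding last_index_def using not_less_Least by blast

lemma sigma_star_le_rho: "sigma_star A b p \<le> rho A b p \<phi> i"
  using sigma_star_least rho_attained by metis

lemma H_eq_s:
  assumes s: "s A b p \<phi> i > 0" and \<sigma>: "\<sigma> \<in> {rho A b p \<phi> i..<rho A b p \<phi> (Suc i)}"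
  shows "H A b p \<sigma> = s A b p \<phi> i"
proof -
  obtain x where x: "lp_norm p (A *v x - b) = rho A b p \<phi> i" "l0_norm x = s A b p \<phi> i"
    using s_attained by metis
  have "s A b p \<phi> i \<le> l0_norm y" if "y \<in> G A b p \<sigma>" for y
  proof (rule ccontr)
    assume "\<not> s A b p \<phi> i \<le> l0_norm y"
    \<comment> \<open>This is exactly the constraint in the minimum defining
      \<open>rho (Suc i)\<close>.\<close>
    then have "l0_norm y \<le> s A b p \<phi> i - 1" by simp
    then have "rho A b p \<phi> (Suc i) \<le> lp_norm p (A *v y - b)" using rho_Suc by metis
    with that \<sigma> show False by (simp add: G_def)
  qed
  with x \<sigma> show ?thesis
    unfolding H_def x(2)[symmetric] by (intro min_value_eqI) (auto simp: G_def)
qed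

lemma Omega_hat_on_step:
  assumes s: "s A b p \<phi> i > 0" and \<sigma>: "\<sigma> \<in> {rho A b p \<phi> i..<rho A b p \<phi> (Suc i)}"
  shows "Omega_hat A b p \<sigma> = {x. lp_norm p (A *v x - b) \<le> \<sigma> \<and> l0_norm x = s A b p \<phi> i}"
proof -
  have "sigma_star A b p \<le> \<sigma>" using \<sigma> sigma_star_le_rho[of i] by simp
  then show ?thesis by (simp add: Omega_hat_eq H_eq_s[OF assms] G_def)
qed

text \<open>Among vectors with \<open>s i\<close> nonzero entries, a residual of at most
  \<open>rho i\<close> must equal \<open>rho i\<close>.\<close>

lemma Omega_hat_rho:
  assumes "s A b p \<phi> i > 0"
  shows "Omega_hat A b p (rho A b p \<phi> i) = Omega A b p \<phi> i"
  using rho_less_rho_Suc[OF assms] rho_le_residual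
  by (auto simp: Omega_hat_on_step[OF assms] Omega_eq intro: order.antisym)

text \<open>Within one step the optimal number of nonzero entries is fixed, so only the residual
  bound is relaxed.\<close>

lemma Omega_hat_mono:
  assumes "s A b p \<phi> i > 0" "\<sigma> \<in> {rho A b p \<phi> i..<rho A b p \<phi> (Suc i)}"
    "\<tau> \<in> {rho A b p \<phi> i..<rho A b p \<phi> (Suc i)}" "\<sigma> \<le> \<tau>"
  shows "Omega_hat A b p \<sigma> \<subseteq> Omega_hat A b p \<tau>"
  using assms by (auto simp: Omega_hat_on_step)

lemma Omega_psubset_Omega_hat:
  assumes p2: "p = 2" and s: "s A b p \<phi> i > 0"
    and \<sigma>: "\<sigma> \<in> {rho A b p \<phi> i<..<rho A b p \<phi> (Suc i)}"
  shows "Omega A b p \<phi> i \<subset> Omega_hat A b p \<sigma>"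
proof -
  let ?f = "\<lambda>x. lp_norm p (A *v x - b)"
  have \<sigma>': "\<sigma> \<in> {rho A b p \<phi> i..<rho A b p \<phi> (Suc i)}" using \<sigma> by simp
  have sub: "Omega A b p \<phi> i \<subseteq> Omega_hat A b p \<sigma>"
    using Omega_hat_on_step[OF s \<sigma>'] \<sigma> by (auto simp: Omega_eq)
  obtain x where x: "?f x = rho A b p \<phi> i" "l0_norm x = s A b p \<phi> i"
    "\<And>y. ?f y = rho A b p \<phi> i \<Longrightarrow> s A b p \<phi> i \<le> l0_norm y"
    by (rule s_attained) blast
  \<comment> \<open>Otherwise the zero vector would have the same residual as \<open>x\<close>,
    contradicting \<open>s i > 0\<close>.\<close>
  have Ax: "A *v x \<noteq> 0"
  proof
    assume "A *v x = 0"
    then have "?f 0 = rho A b p \<phi> i" using x(1) by simp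
    from x(3)[OF this] s show False by simp
  qed
  define g where "g = (\<lambda>t. ?f (t *\<^sub>R x))"
  have "continuous_on UNIV g"
    unfolding g_def matrix_vector_mult_scaleR by (intro continuous_on_lp_norm continuous_intros)
  then have "isCont g 1" by (simp add: continuous_on_eq_continuous_at)
  moreover have "g 1 < \<sigma>" using x(1) \<sigma> by (simp add: g_def)
  ultimately have "\<forall>\<^sub>F t in nhds 1. g t < \<sigma>"
    by (auto simp: isCont_def tendsto_at_iff_tendsto_nhds dest: order_tendstoD(2))
  then obtain d where d: "d > 0" "\<And>t. dist t 1 < d \<Longrightarrow> g t < \<sigma>"
    unfolding eventually_nhds_metric by blast
  \<comment> \<open>\<open>e < d\<close> keeps both residuals below \<open>\<sigma>\<close>;
    \<open>e < 1\<close> keeps both factors nonzero, hence the support unchanged.\<close>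
  define e where "e = min d 1 / 2"
  have e: "0 < e" "e < d" "e < 1" using d(1) by (auto simp: e_def)
  have mem: "t *\<^sub>R x \<in> Omega_hat A b p \<sigma>" if "t \<in> {1 - e, 1 + e}" for t
  proof -
    have "dist t 1 < d" "t \<noteq> 0" using that e by (auto simp: dist_real_def)
    then show ?thesis
      using d(2)[of t] x(2) by (simp add: Omega_hat_on_step[OF s \<sigma>'] l0_norm_scaleR g_def)
  qed
  have "\<exists>t\<in>{1 - e, 1 + e}. t *\<^sub>R x \<notin> Omega A b p \<phi> i"
  proof (rule ccontr)
    assume "\<not> ?thesis"
    then have same: "?f ((1 - e) *\<^sub>R x) = ?f x" "?f ((1 + e) *\<^sub>R x) = ?f x"
      using x(1) by (auto simp: Omega_eq)
    define u v where "u = A *v x - b" and "v = e *\<^sub>R (A *v x)"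
    have "A *v ((1 - e) *\<^sub>R x) - b = u - v" "A *v ((1 + e) *\<^sub>R x) - b = u + v"
      by (simp_all add: u_def v_def matrix_vector_mult_scaleR algebra_simps)
    then have eq: "norm (u - v) = norm u" "norm (u + v) = norm u"
      using same unfolding p2 lp_norm_2 by (simp_all only: u_def)
    \<comment> \<open>In the parallelogram law, equality of all three residual norms leaves no room
      for \<open>v\<close>.\<close>
    have "(norm (u - v))\<^sup>2 + (norm (u + v))\<^sup>2 = 2 * (norm u)\<^sup>2 + 2 * (norm v)\<^sup>2"
      by (simp add: power2_norm_eq_inner inner_simps inner_commute)
    then have "v = 0" by (simp add: eq)
    with Ax e show False by (simp add: v_def)
  qed
  with sub mem show ?thesis by blast
qed

end

end

section \<open>Assembly of the four claims\<close>

theorem theorem3p4: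
  fixes A :: "real^'n^'m" and b :: "real^'m" and p :: nat and \<phi> :: "real \<Rightarrow> real"
  assumes p: "p \<in> {1, 2}"
    and phi: "\<And>z. 0 \<le> z \<Longrightarrow> \<phi> z = z"
  shows
    "\<comment> \<open>(i)\<close>
     (\<forall>i < last_index A b p \<phi>. \<forall>\<sigma> \<in> {rho A b p \<phi> i..<rho A b p \<phi> (i + 1)}.
        H A b p \<sigma> = s A b p \<phi> i) \<and>
     (\<forall>\<sigma> \<ge> lp_norm p b. H A b p \<sigma> = 0) \<and>
     \<comment> \<open>(ii)\<close>
     (\<forall>i < last_index A b p \<phi>. Omega_hat A b p (rho A b p \<phi> i) = Omega A b p \<phi> i) \<and>
     (\<forall>i < last_index A b p \<phi>. \<forall>\<sigma> \<in> {rho A b p \<phi> i<..<rho A b p \<phi> (i + 1)}.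
        Omega A b p \<phi> i \<subseteq> Omega_hat A b p \<sigma>) \<and>
     (\<forall>\<sigma> \<ge> lp_norm p b. Omega_hat A b p \<sigma> = {0}) \<and>
     (p = 2 \<longrightarrow>
       (\<forall>i < last_index A b p \<phi>. \<forall>\<sigma> \<in> {rho A b p \<phi> i<..<rho A b p \<phi> (i + 1)}.
          Omega A b p \<phi> i \<subset> Omega_hat A b p \<sigma>)) \<and>
     \<comment> \<open>(iii)\<close>
     piecewise_constant_on {sigma_star A b p..} (\<lambda>\<sigma>. real (H A b p \<sigma>)) \<and>
     finite (H A b p ` {sigma_star A b p..}) \<and>
     card (H A b p ` {sigma_star A b p..}) \<le> rank A + 1 \<and>
     lower_semicontinuous_on {sigma_star A b p..} (\<lambda>\<sigma>. real (H A b p \<sigma>)) \<and>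
     (\<forall>\<sigma> \<ge> sigma_star A b p. continuous (at_right \<sigma>) (\<lambda>t. real (H A b p t))) \<and>
     antimono_on {sigma_star A b p..} (H A b p) \<and>
     \<comment> \<open>(iv)\<close>
     (\<forall>i < last_index A b p \<phi>. \<forall>\<sigma>1 \<in> {rho A b p \<phi> i..<rho A b p \<phi> (i + 1)}.
        \<forall>\<sigma>2 \<in> {rho A b p \<phi> i..<rho A b p \<phi> (i + 1)}.
          \<sigma>1 \<le> \<sigma>2 \<longrightarrow> Omega_hat A b p \<sigma>1 \<subseteq> Omega_hat A b p \<sigma>2)"
proof -
  note pos = s_pos_if_less_last_index
  let ?S = "{sigma_star A b p..}"
  have anti: "antimono_on ?S (H A b p)"
    using H_antimono[OF p] by (auto simp: monotone_on_def)
  \<comment> \<open>Counting the value 0 gives the bound \<open>rank A + 1\<close>.\<close>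
  have sub: "H A b p ` ?S \<subseteq> {..rank A}"
    using H_le_rank[OF p] by auto
  then have fin: "finite (H A b p ` ?S)"
    using finite_subset by blast
  have card: "card (H A b p ` ?S) \<le> rank A + 1"
    using card_mono[OF _ sub] by simp
  have "(\<lambda>\<sigma>. real (H A b p \<sigma>)) ` ?S = real ` H A b p ` ?S"
    by (simp add: image_image)
  then have pc: "piecewise_constant_on ?S (\<lambda>\<sigma>. real (H A b p \<sigma>))"
    using fin anti
    by (intro piecewise_constant_on_antimono) (auto simp: monotone_on_def is_interval_1)
  \<comment> \<open>\<open>Omega i\<close> is \<open>Omega_hat\<close> at the left endpoint
    \<open>rho i\<close>, so monotonicity within the step gives the inclusion.\<close>
  have Omega_sub: "Omega A b p \<phi> i \<subseteq> Omega_hat A b p \<sigma>"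
    if "i < last_index A b p \<phi>" "\<sigma> \<in> {rho A b p \<phi> i<..<rho A b p \<phi> (i + 1)}" for i \<sigma>
    using Omega_hat_rho[OF p phi pos[OF p phi that(1)]]
      Omega_hat_mono[OF p phi pos[OF p phi that(1)], of "rho A b p \<phi> i" \<sigma>] that(2) by auto
  show ?thesis
    apply (intro conjI allI impI ballI)
    subgoal using H_eq_s[OF p phi pos[OF p phi]] by simp
    subgoal using H_eq_0[OF p] .
    subgoal using Omega_hat_rho[OF p phi pos[OF p phi]] .
    subgoal using Omega_sub .
    subgoal using Omega_hat_eq_singleton[OF p] .
    subgoal using Omega_psubset_Omega_hat[OF p phi _ pos[OF p phi]] by simp
    subgoal using pc .
    subgoal using fin .
    subgoal using card .
    subgoal using lower_semicontinuous_on_H[OF p] .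
    subgoal using continuous_at_right_H[OF p] .
    subgoal using anti .
    subgoal by (rule Omega_hat_mono[OF p phi pos[OF p phi]]) auto
    done
qed

end
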